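(* Let $\mathfrak{I}=(X,\mathcal{F},\Sigma)$ be an iterated function system such that all maps in $\mathcal{F}$ are contractions and $\mathcal{F}$ preserves the attractor $S$ of $\mathfrak{I}$. Let $P$ be one of the properties: Devaney chaos, mixing, weak mixing, totally transitive. If $\Sigma$ (i.e. $(\Sigma,\tau)$) has property $P$, then the IFS $\mathfrak{I}_S=(S,\mathcal{F},\Sigma)$ has property $P$ as well.
   Context: $X$ is a nonempty compact metric space with metric $d$; $\mathcal{A}=\{1,\dots,k\}$, $k\ge2$; $\Sigma\subseteq\mathcal{A}^{\mathbb{N}}$ is a nonempty sub-shift, i.e. closed and $\tau(\Sigma)\subseteq\Sigma$ for the shift map $\tau(\sigma_1\sigma_2\sigma_3\cdots)=\sigma_2\sigma_3\cdots$. $\mathcal{L}_n(\Sigma)$ is the set of words of length $n$ occurring in points of $\Sigma$, $\mathcal{L}(\Sigma)=\bigcup_n\mathcal{L}_n(\Sigma)$. $\mathcal{F}=\{f_1,\dots,f_k\}$, with $d(f_i(x),f_i(y))\le r_i d(x,y)$, $0\le r_i<1$, and $f_u:=f_{u_n}\circ\cdots\circ f_{u_1}$ for $u=u_1\cdots u_n$. For nonempty compact $A\subseteq X$, $H^n(A):=\bigcup_{u\in\mathcal{L}_n(\Sigma)}f_u(A)$. The attractor is $S:=\lim_{n\to\infty}H^n(X)$ in the Hausdorff metric (the limit exists). $\mathcal{F}$ preserves $S$ means $f_i(S)\subseteq S$ for all $i$; then $\mathfrak{I}_S=(S,\mathcal{F},\Sigma)$ (maps restricted to $S$) is an IFS.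 For an IFS $(Y,\mathcal{F},\Sigma)$ and nonempty open $U,V\subseteq Y$, let $N(U,V)=\{n\in\mathbb{N}:U\cap f_u^{-1}(V)\ne\emptyset\text{ for some }u\in\mathcal{L}_n(\Sigma)\}$. The IFS is: (topologically) transitive if $N(U,V)\ne\emptyset$ for all nonempty open $U,V$; totally transitive if for every $N\in\mathbb{N}$ the IFS $(Y,\{f_u:u\in\mathcal{L}_N(\Sigma)\},\Sigma^N)$ is transitive, where $\Sigma^N$ is the $N$-th higher power shift (alphabet $\mathcal{L}_N(\Sigma)$, points obtained by cutting points of $\Sigma$ into consecutive $N$-blocks); weak mixing if every $N(U,V)$ is thick (contains arbitrarily long intervals of $\mathbb{N}$); mixing if every $N(U,V)$ is cofinite; Devaney chaotic if it is transitive and its periodic points are dense in $Y$, where $x\in Y$ is periodic of period $p$ if there is $u\in\mathcal{L}_p(\Sigma)$ with $u^\infty\in\Sigma$ and $f_u(x)=x$. For the sub-shift $(\Sigma,\tau)$ the properties are the classical ones, with $N(U,V)=\{n\in\mathbb{N}:U\cap\tau^{-n}(V)\neq\emptyset\}$ for nonempty open $U,V\subseteq\Sigma$: transitive if all $N(U,V)\neq\emptyset$; totally transitive if $\tau^N$ is transitive for every $N\in\mathbb{N}$; weak mixing if all $N(U,V)$ are thick; mixing if all $N(U,V)$ are cofinite; Devaney chaos if transitive with dense periodic points. *)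

theory Defs
  imports "HOL-Analysis.Analysis"
begin

(* The natural numbers start at 1 in all dynamical definitions below: return times, powers of a
   map and periods are at least 1. Infinite words are functions on nat indexed from 0, and their
   space carries the product topology of Function_Topology (nat is discrete). *)

definition thick :: "nat set \<Rightarrow> bool" where
  "thick A \<longleftrightarrow> (\<forall>l. \<exists>m. {m..m + l} \<subseteq> A)"

definition cofinite_set :: "nat set \<Rightarrow> bool" where
  "cofinite_set A \<longleftrightarrow> finite (- A)"

subsection \<open>Classical dynamical systems on a subspace\<close>

definition ds_times :: "('b \<Rightarrow> 'b) \<Rightarrow> 'b set \<Rightarrow> 'b set \<Rightarrow> nat set" where
  "ds_times T U V = {n. 1 \<le> n \<and> U \<inter> (T ^^ n) -` V \<noteq> {}}"

definition ds_transitive :: "'b::topological_space set \<Rightarrow> ('b \<Rightarrow> 'b) \<Rightarrow> bool" where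
  "ds_transitive Y T \<longleftrightarrow>
    (\<forall>U V. openin (top_of_set Y) U \<and> U \<noteq> {} \<and> openin (top_of_set Y) V \<and> V \<noteq> {}
       \<longrightarrow> ds_times T U V \<noteq> {})"

definition ds_totally_transitive :: "'b::topological_space set \<Rightarrow> ('b \<Rightarrow> 'b) \<Rightarrow> bool" where
  "ds_totally_transitive Y T \<longleftrightarrow> (\<forall>N\<ge>1. ds_transitive Y (T ^^ N))"

definition ds_weak_mixing :: "'b::topological_space set \<Rightarrow> ('b \<Rightarrow> 'b) \<Rightarrow> bool" where
  "ds_weak_mixing Y T \<longleftrightarrow>
    (\<forall>U V. openin (top_of_set Y) U \<and> U \<noteq> {} \<and> openin (top_of_set Y) V \<and> V \<noteq> {}
       \<longrightarrow> thick (ds_times T U V))"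

definition ds_mixing :: "'b::topological_space set \<Rightarrow> ('b \<Rightarrow> 'b) \<Rightarrow> bool" where
  "ds_mixing Y T \<longleftrightarrow>
    (\<forall>U V. openin (top_of_set Y) U \<and> U \<noteq> {} \<and> openin (top_of_set Y) V \<and> V \<noteq> {}
       \<longrightarrow> cofinite_set (ds_times T U V))"

definition ds_periodic_points :: "'b set \<Rightarrow> ('b \<Rightarrow> 'b) \<Rightarrow> 'b set" where
  "ds_periodic_points Y T = {x \<in> Y. \<exists>p\<ge>1. (T ^^ p) x = x}"

definition ds_devaney_chaotic :: "'b::topological_space set \<Rightarrow> ('b \<Rightarrow> 'b) \<Rightarrow> bool" where
  "ds_devaney_chaotic Y T \<longleftrightarrow>
    ds_transitive Y T \<and> Y \<subseteq> closure (ds_periodic_points Y T)"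

subsection \<open>Sub-shifts\<close>

definition shift_map :: "(nat \<Rightarrow> 'c) \<Rightarrow> nat \<Rightarrow> 'c" where
  "shift_map s = (\<lambda>n. s (Suc n))"

definition subshift :: "nat set \<Rightarrow> (nat \<Rightarrow> nat) set \<Rightarrow> bool" where
  "subshift A \<Sigma> \<longleftrightarrow>
    \<Sigma> \<noteq> {} \<and> (\<forall>s\<in>\<Sigma>. range s \<subseteq> A) \<and> closed \<Sigma> \<and> shift_map ` \<Sigma> \<subseteq> \<Sigma>"

definition language :: "nat \<Rightarrow> (nat \<Rightarrow> 'c) set \<Rightarrow> 'c list set" where
  "language n \<Sigma> = {map s [m..<m + n] | s m. s \<in> \<Sigma>}"

definition power_shift :: "nat \<Rightarrow> (nat \<Rightarrow> 'c) set \<Rightarrow> (nat \<Rightarrow> 'c list) set" where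
  "power_shift N \<Sigma> = (\<lambda>s i. map s [i * N..<(i + 1) * N]) ` \<Sigma>"

definition infinite_repetition :: "'c list \<Rightarrow> nat \<Rightarrow> 'c" where
  "infinite_repetition u = (\<lambda>n. u ! (n mod length u))"

subsection \<open>Iterated function systems\<close>

(* An IFS is given by its phase space Y, a family f of maps indexed by letters, and a set of
   infinite words. For a finite word u, the map f_u is fold f u, which applies the map of the
   first letter first. *)

definition ifs_times ::
  "('c \<Rightarrow> 'a \<Rightarrow> 'a) \<Rightarrow> (nat \<Rightarrow> 'c) set \<Rightarrow> 'a set \<Rightarrow> 'a set \<Rightarrow> nat set" where
  "ifs_times f \<Sigma> U V = {n. 1 \<le> n \<and> (\<exists>u\<in>language n \<Sigma>. U \<inter> fold f u -` V \<noteq> {})}"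

definition ifs_transitive ::
  "'a::topological_space set \<Rightarrow> ('c \<Rightarrow> 'a \<Rightarrow> 'a) \<Rightarrow> (nat \<Rightarrow> 'c) set \<Rightarrow> bool" where
  "ifs_transitive Y f \<Sigma> \<longleftrightarrow>
    (\<forall>U V. openin (top_of_set Y) U \<and> U \<noteq> {} \<and> openin (top_of_set Y) V \<and> V \<noteq> {}
       \<longrightarrow> ifs_times f \<Sigma> U V \<noteq> {})"

(* The letters of power_shift N \<Sigma> are words w of length N, and the map attached to
   the letter w is f_w = fold f w; the new family of maps is therefore fold f itself. *)
definition ifs_totally_transitive ::
  "'a::topological_space set \<Rightarrow> ('c \<Rightarrow> 'a \<Rightarrow> 'a) \<Rightarrow> (nat \<Rightarrow> 'c) set \<Rightarrow> bool" where
  "ifs_totally_transitive Y f \<Sigma> \<longleftrightarrow>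
    (\<forall>N\<ge>1. ifs_transitive Y (fold f) (power_shift N \<Sigma>))"

definition ifs_weak_mixing ::
  "'a::topological_space set \<Rightarrow> ('c \<Rightarrow> 'a \<Rightarrow> 'a) \<Rightarrow> (nat \<Rightarrow> 'c) set \<Rightarrow> bool" where
  "ifs_weak_mixing Y f \<Sigma> \<longleftrightarrow>
    (\<forall>U V. openin (top_of_set Y) U \<and> U \<noteq> {} \<and> openin (top_of_set Y) V \<and> V \<noteq> {}
       \<longrightarrow> thick (ifs_times f \<Sigma> U V))"

definition ifs_mixing ::
  "'a::topological_space set \<Rightarrow> ('c \<Rightarrow> 'a \<Rightarrow> 'a) \<Rightarrow> (nat \<Rightarrow> 'c) set \<Rightarrow> bool" where
  "ifs_mixing Y f \<Sigma> \<longleftrightarrow>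
    (\<forall>U V. openin (top_of_set Y) U \<and> U \<noteq> {} \<and> openin (top_of_set Y) V \<and> V \<noteq> {}
       \<longrightarrow> cofinite_set (ifs_times f \<Sigma> U V))"

definition ifs_periodic_points ::
  "'a set \<Rightarrow> ('c \<Rightarrow> 'a \<Rightarrow> 'a) \<Rightarrow> (nat \<Rightarrow> 'c) set \<Rightarrow> 'a set" where
  "ifs_periodic_points Y f \<Sigma> =
    {x \<in> Y. \<exists>p\<ge>1. \<exists>u\<in>language p \<Sigma>. infinite_repetition u \<in> \<Sigma> \<and> fold f u x = x}"

definition ifs_devaney_chaotic ::
  "'a::topological_space set \<Rightarrow> ('c \<Rightarrow> 'a \<Rightarrow> 'a) \<Rightarrow> (nat \<Rightarrow> 'c) set \<Rightarrow> bool" where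
  "ifs_devaney_chaotic Y f \<Sigma> \<longleftrightarrow>
    ifs_transitive Y f \<Sigma> \<and> Y \<subseteq> closure (ifs_periodic_points Y f \<Sigma>)"

subsection \<open>The attractor\<close>

definition hutchinson ::
  "('c \<Rightarrow> 'a \<Rightarrow> 'a) \<Rightarrow> (nat \<Rightarrow> 'c) set \<Rightarrow> nat \<Rightarrow> 'a set \<Rightarrow> 'a set" where
  "hutchinson f \<Sigma> n A = (\<Union>u\<in>language n \<Sigma>. fold f u ` A)"

(* Only meaningful for nonempty bounded sets, since Sup on the reals is. *)
definition hausdorff_distance :: "'a::metric_space set \<Rightarrow> 'a set \<Rightarrow> real" where
  "hausdorff_distance A B = max (SUP a\<in>A. infdist a B) (SUP b\<in>B. infdist b A)"

(* S is the limit of the sets H^n(X) in the space of nonempty compact subsets of X. *)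
definition is_attractor ::
  "'a::metric_space set \<Rightarrow> ('c \<Rightarrow> 'a \<Rightarrow> 'a) \<Rightarrow> (nat \<Rightarrow> 'c) set \<Rightarrow> 'a set \<Rightarrow> bool" where
  "is_attractor X f \<Sigma> S \<longleftrightarrow> S \<noteq> {} \<and> compact S \<and> S \<subseteq> X \<and>
    (\<lambda>n. hausdorff_distance (hutchinson f \<Sigma> n X) S) \<longlonglongrightarrow> 0"

(* For contractions on a nonempty compact X the limit exists and is unique. *)
definition attractor ::
  "'a::metric_space set \<Rightarrow> ('c \<Rightarrow> 'a \<Rightarrow> 'a) \<Rightarrow> (nat \<Rightarrow> 'c) set \<Rightarrow> 'a set" where
  "attractor X f \<Sigma> = (THE S. is_attractor X f \<Sigma> S)"

end

theory Submission
  imports Defs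
begin

text \<open>
  The idea of the proof. Let \<open>H n\<close> be the union of the sets \<open>fold f u ` X\<close> over
  the admissible words \<open>u\<close> of length \<open>n\<close>. Deleting the first letter of an admissible
  word leaves an admissible word, and the first letter is applied first, so the compact sets
  \<open>H n\<close> decrease; their Hausdorff limit \<open>S\<close> is therefore their intersection
  (\<open>hausdorff_limit_decreasing_iff\<close>). In particular a point \<open>y\<close> of \<open>S\<close>
  lies in some \<open>fold f u ` X\<close> with \<open>u\<close> of length \<open>n\<close>, for \<^emph>\<open>every\<close>
  \<open>n\<close>. Since the maps contract with a common factor \<open>c < 1\<close>, these images have diameter
  at most \<open>c ^ n * diameter X\<close>, so all long lengths \<open>n\<close> provide a word that sends the
  whole of \<open>X\<close> into a prescribed neighbourhood of \<open>y\<close>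
  (\<open>eventually_image_in_ball\<close>).

  As \<open>S\<close> is invariant, such a word takes any given point of \<open>S\<close> into any given
  nonempty open subset of \<open>S\<close>. So all large \<open>n\<close> are return times: this is mixing, and
  weak mixing and transitivity follow. Words whose length is a multiple of \<open>N\<close> can be cut into
  \<open>N\<close>-blocks, which gives total transitivity.

  For the density of periodic points, take a word \<open>v\<close> that sends \<open>X\<close> close to
  \<open>y\<close>. If periodic points are dense in the sub-shift, then \<open>v\<close> is a prefix of a
  periodic point, and, reading this point cyclically, \<open>v\<close> is also a suffix of a word
  \<open>u\<close> whose infinite repetition is admissible. The contraction \<open>fold f u\<close> has a fixed
  point in \<open>S\<close>, and since \<open>v\<close> is applied last, this fixed point is close to
  \<open>y\<close>.
\<close>

section \<open>Hausdorff limits of decreasing sequences of compact sets\<close>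

text \<open>
  The open sets \<open>U \<union> - K n\<close> increase and cover \<open>K 0\<close>, so one of them
  contains \<open>K 0\<close>. The case of empty \<open>U\<close> says that the intersection of
  nonempty sets \<open>K n\<close> is nonempty.
\<close>
lemma decseq_compact_subset_open:
  fixes K :: "nat \<Rightarrow> 'a::t2_space set"
  assumes K: "\<And>n. compact (K n)" and dec: "decseq K" and U: "open U" "(\<Inter>n. K n) \<subseteq> U"
  obtains n where "K n \<subseteq> U"
proof -
  have "K 0 \<subseteq> (\<Union>n\<in>UNIV. U \<union> - K n)" using U by blast
  moreover have "open (U \<union> - K n)" for n
    using U K by (simp add: compact_imp_closed open_Un open_Compl)
  ultimately obtain C where C: "finite C" "K 0 \<subseteq> (\<Union>n\<in>C. U \<union> - K n)"
    using compactE_image[OF K[of 0], of UNIV "\<lambda>n. U \<union> - K n"] by auto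
  have "x \<in> U" if x: "x \<in> K (Max (insert 0 C))" for x
  proof -
    have "x \<in> K n" if "n \<in> insert 0 C" for n
      using x decseqD[OF dec, of n "Max (insert 0 C)"] C(1) that by auto
    then show ?thesis using C(2) by blast
  qed
  then show ?thesis using that by blast
qed

lemma bdd_above_infdist_image:
  assumes "compact A"
  shows "bdd_above ((\<lambda>a. infdist a B) ` A)"
  by (intro bounded_imp_bdd_above compact_imp_bounded compact_continuous_image
      continuous_on_infdist continuous_on_id assms)

lemma infdist_le_hausdorff_distance:
  assumes "compact A" "compact B"
  shows "a \<in> A \<Longrightarrow> infdist a B \<le> hausdorff_distance A B"
    and "b \<in> B \<Longrightarrow> infdist b A \<le> hausdorff_distance A B"
  unfolding hausdorff_distance_def
  using cSUP_upper[OF _ bdd_above_infdist_image[OF assms(1), of B], of a]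
    cSUP_upper[OF _ bdd_above_infdist_image[OF assms(2), of A], of b]
  by (auto intro: max.coboundedI1 max.coboundedI2)

text \<open>
  A point of a Hausdorff limit \<open>L\<close> has distance \<open>0\<close> to each \<open>K n\<close>, by
  monotonicity, and a point of the intersection has distance \<open>0\<close> to \<open>L\<close>. Conversely,
  by compactness the sets \<open>K n\<close> are eventually contained in every neighbourhood of their
  intersection.
\<close>
lemma hausdorff_limit_decreasing_iff:
  fixes K :: "nat \<Rightarrow> 'a::metric_space set"
  assumes K: "\<And>n. compact (K n)" "\<And>n. K n \<noteq> {}" and dec: "decseq K"
    and L: "compact L" "L \<noteq> {}"
  shows "(\<lambda>n. hausdorff_distance (K n) L) \<longlonglongrightarrow> 0 \<longleftrightarrow> L = (\<Inter>n. K n)"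
proof
  assume lim: "(\<lambda>n. hausdorff_distance (K n) L) \<longlonglongrightarrow> 0"
  show "L = (\<Inter>n. K n)"
  proof (intro set_eqI iffI)
    fix y assume y: "y \<in> L"
    have "y \<in> K n" for n
    proof -
      have "infdist y (K n) \<le> hausdorff_distance (K m) L" if "m \<ge> n" for m
      proof -
        have "infdist y (K n) \<le> infdist y (K m)"
          using infdist_mono[OF decseqD[OF dec that] K(2)] .
        also have "\<dots> \<le> hausdorff_distance (K m) L"
          using infdist_le_hausdorff_distance(2)[OF K(1) L(1) y] .
        finally show ?thesis .
      qed
      then have "infdist y (K n) \<le> 0" by (intro LIMSEQ_le_const[OF lim]) blast
      then show ?thesis
        using in_closed_iff_infdist_zero[OF compact_imp_closed[OF K(1)] K(2)] infdist_nonneg[of y]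
        by (metis order_antisym)
    qed
    then show "y \<in> (\<Inter>n. K n)" by blast
  next
    fix y assume "y \<in> (\<Inter>n. K n)"
    then have "infdist y L \<le> hausdorff_distance (K n) L" for n
      using infdist_le_hausdorff_distance(1)[OF K(1) L(1)] by blast
    then have "infdist y L \<le> 0" by (intro LIMSEQ_le_const[OF lim]) blast
    then show "y \<in> L"
      using in_closed_iff_infdist_zero[OF compact_imp_closed[OF L(1)] L(2)] infdist_nonneg[of y]
      by (metis order_antisym)
  qed
next
  assume eq: "L = (\<Inter>n. K n)"
  show "(\<lambda>n. hausdorff_distance (K n) L) \<longlonglongrightarrow> 0"
  proof (rule LIMSEQ_I)
    fix e :: real assume e: "e > 0"
    have "open ((\<lambda>x. infdist x L) -` {..<e / 2})"
      by (intro open_vimage open_lessThan continuous_on_infdist continuous_on_id)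
    moreover have "(\<Inter>n. K n) \<subseteq> (\<lambda>x. infdist x L) -` {..<e / 2}"
      using e by (auto simp flip: eq)
    ultimately obtain N where N: "K N \<subseteq> (\<lambda>x. infdist x L) -` {..<e / 2}"
      using decseq_compact_subset_open[OF K(1) dec] by metis
    have "norm (hausdorff_distance (K n) L - 0) < e" if "n \<ge> N" for n
    proof -
      have "infdist x L \<le> e / 2" if "x \<in> K n" for x
        using N decseqD[OF dec \<open>n \<ge> N\<close>] that by fastforce
      then have "(SUP x\<in>K n. infdist x L) \<le> e / 2"
        using K(2) by (intro cSUP_least)
      moreover have "(SUP x\<in>L. infdist x (K n)) \<le> e / 2"
        using L(2) e eq by (intro cSUP_least) auto
      ultimately have "hausdorff_distance (K n) L \<le> e / 2"
        by (simp add: hausdorff_distance_def)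
      moreover have "0 \<le> hausdorff_distance (K n) L"
        using infdist_le_hausdorff_distance(2)[OF K(1) L(1)] L(2) infdist_nonneg order_trans
        by (metis ex_in_conv)
      ultimately show ?thesis using e by simp
    qed
    then show "\<exists>N. \<forall>n\<ge>N. norm (hausdorff_distance (K n) L - 0) < e" by blast
  qed
qed

section \<open>Words of a sub-shift\<close>

lemma funpow_shift_map: "(shift_map ^^ m) s = (\<lambda>n. s (n + m))"
  by (induction m) (auto simp: shift_map_def)

lemma subshift_shifted:
  assumes "subshift A \<Sigma>" "s \<in> \<Sigma>"
  shows "(\<lambda>n. s (n + m)) \<in> \<Sigma>"
proof -
  have "(shift_map ^^ m) s \<in> \<Sigma>"
    using assms by (induction m) (auto simp: subshift_def)
  then show ?thesis by (simp add: funpow_shift_map)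
qed

lemma map_shifted: "map (\<lambda>n. s (n + m)) [0..<n] = map s [m..<m + n]"
  by (rule nth_equalityI) (auto simp: add.commute)

lemma subshift_language:
  assumes "subshift A \<Sigma>"
  shows "language n \<Sigma> = (\<lambda>s. map s [0..<n]) ` \<Sigma>"
proof
  show "language n \<Sigma> \<subseteq> (\<lambda>s. map s [0..<n]) ` \<Sigma>"
  proof
    fix u assume "u \<in> language n \<Sigma>"
    then obtain s m where "s \<in> \<Sigma>" "u = map s [m..<m + n]"
      unfolding language_def by blast
    then show "u \<in> (\<lambda>s. map s [0..<n]) ` \<Sigma>"
      using subshift_shifted[OF assms, of s m] map_shifted[of s m n] by (metis image_eqI)
  qed
  show "(\<lambda>s. map s [0..<n]) ` \<Sigma> \<subseteq> language n \<Sigma>"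
    unfolding language_def by (force intro: exI[of _ 0])
qed

lemma language_length: "u \<in> language n \<Sigma> \<Longrightarrow> length u = n"
  by (auto simp: language_def)

lemma subshift_language_letters:
  assumes "subshift A \<Sigma>" "u \<in> language n \<Sigma>"
  shows "set u \<subseteq> A"
proof -
  obtain s m where "s \<in> \<Sigma>" "u = map s [m..<m + n]"
    using assms(2) unfolding language_def by blast
  moreover have "range s \<subseteq> A" using assms(1) \<open>s \<in> \<Sigma>\<close> by (simp add: subshift_def)
  ultimately show ?thesis by auto
qed

lemma subshift_language_tl:
  assumes "subshift A \<Sigma>" "u \<in> language (Suc n) \<Sigma>"
  shows "tl u \<in> language n \<Sigma>"
proof -
  obtain s m where "s \<in> \<Sigma>" and u: "u = map s [m..<m + Suc n]"
    using assms(2) unfolding language_def by blast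
  moreover have "tl u = map s [Suc m..<Suc m + n]"
    unfolding u by (simp flip: map_tl)
  ultimately show ?thesis unfolding language_def by blast
qed

lemma concat_blocks: "concat (map (\<lambda>i. map s [i * N..<(i + 1) * N]) [0..<n]) = map s [0..<n * N]"
proof (induction n)
  case (Suc n)
  have "[0..<Suc n * N] = [0..<n * N] @ [n * N..<Suc n * N]"
    by (metis add.commute le0 mult_Suc upt_add_eq_append)
  with Suc show ?case by simp
qed simp

text \<open>
  The letters of the power shift are blocks that start at multiples of \<open>N\<close>, while an
  admissible word may start anywhere. Shift invariance moves its start to \<open>0\<close>.
\<close>
lemma language_concat_power_shift:
  assumes "subshift A \<Sigma>" "u \<in> language (n * N) \<Sigma>"
  obtains w where "w \<in> language n (power_shift N \<Sigma>)" "concat w = u"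
proof -
  obtain s where s: "s \<in> \<Sigma>" "u = map s [0..<n * N]"
    using assms by (auto simp: subshift_language)
  define t where "t = (\<lambda>i. map s [i * N..<(i + 1) * N])"
  have "t \<in> power_shift N \<Sigma>"
    using s(1) unfolding t_def power_shift_def by blast
  then have "map t [0..<0 + n] \<in> language n (power_shift N \<Sigma>)"
    unfolding language_def by blast
  moreover have "concat (map t [0..<0 + n]) = u"
    unfolding t_def s(2) by (simp only: add_0 concat_blocks)
  ultimately show ?thesis by (rule that)
qed

lemma fold_fold_eq_fold_concat: "fold (fold f) w = fold f (concat w)"
  by (induction w) auto

lemma open_cylinder: "open {t :: nat \<Rightarrow> nat. \<forall>i<m. t i = s i}"
proof -
  have "open ((\<lambda>t :: nat \<Rightarrow> nat. t i) -` {s i})" for i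
    by (intro open_vimage open_discrete continuous_on_product_coordinates)
  then have "open (\<Inter>i\<in>{..<m}. (\<lambda>t :: nat \<Rightarrow> nat. t i) -` {s i})"
    by (intro open_INT) auto
  also have "(\<Inter>i\<in>{..<m}. (\<lambda>t :: nat \<Rightarrow> nat. t i) -` {s i}) = {t. \<forall>i<m. t i = s i}"
    by auto
  finally show ?thesis .
qed

lemma infinite_repetition_periodic:
  assumes "p \<ge> 1" "\<And>n. s (n + p) = s n"
  shows "infinite_repetition (map s [0..<p]) = s"
proof
  fix n
  have "s (i + q * p) = s i" for i q
  proof (induction q)
    case (Suc q)
    have "s (i + Suc q * p) = s (i + q * p + p)" by (simp add: algebra_simps)
    with Suc show ?case using assms(2) by simp
  qed simp
  from this[of "n mod p" "n div p"] show "infinite_repetition (map s [0..<p]) n = s n"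
    using assms(1) by (simp add: infinite_repetition_def)
qed

text \<open>
  The multiples of a period are periods, so a periodic point \<open>t\<close> in the cylinder of
  \<open>v\<close> has a period \<open>p\<close> that is at least the length \<open>m\<close> of \<open>v\<close>.
  The word \<open>t m \<dots> t (m + p - 1)\<close> then ends with
  \<open>t p \<dots> t (m + p - 1)\<close>, which is \<open>v\<close>, and its infinite repetition is the
  shift of \<open>t\<close> by \<open>m\<close>.
\<close>
lemma dense_periodic_word_extension:
  assumes \<Sigma>: "subshift A \<Sigma>" and dense: "\<Sigma> \<subseteq> closure (ds_periodic_points \<Sigma> shift_map)"
    and v: "v \<in> language m \<Sigma>"
  obtains w where "w @ v \<noteq> []" "w @ v \<in> language (length (w @ v)) \<Sigma>"
    "infinite_repetition (w @ v) \<in> \<Sigma>"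
proof -
  obtain s where s: "s \<in> \<Sigma>" "v = map s [0..<m]"
    using v \<Sigma> by (auto simp: subshift_language)
  have "s \<in> closure (ds_periodic_points \<Sigma> shift_map)" using s dense by blast
  moreover have "s \<in> {t. \<forall>i<m. t i = s i}" by simp
  ultimately have "ds_periodic_points \<Sigma> shift_map \<inter> {t. \<forall>i<m. t i = s i} \<noteq> {}"
    using open_cylinder[of m s] unfolding closure_iff_nhds_not_empty by blast
  then obtain t q where t: "t \<in> \<Sigma>" "q \<ge> 1" "(shift_map ^^ q) t = t" "\<forall>i<m. t i = s i"
    unfolding ds_periodic_points_def by blast
  \<comment> \<open>A multiple of the period \<open>q\<close> that exceeds \<open>m\<close>; the summand
    \<open>1\<close> keeps \<open>p\<close> positive when \<open>v\<close> is empty.\<close>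
  define p where "p = q * (m + 1)"
  have "(shift_map ^^ p) t = t"
    unfolding p_def by (induction m) (use t(3) in \<open>auto simp: funpow_add\<close>)
  then have per: "t (n + p) = t n" for n by (metis funpow_shift_map)
  have "1 * (m + 1) \<le> p" unfolding p_def using t(2) by (rule mult_le_mono1)
  then have p: "p \<ge> 1" "m \<le> p" by auto
  define w where "w = map t [m..<p]"
  have tail: "map t [p..<m + p] = v"
    unfolding s(2) using t(4) per by (intro nth_equalityI) (auto simp: add.commute[of p])
  then have u: "w @ v = map t [m..<m + p]"
    using upt_add_eq_append[OF p(2), of m] by (simp add: w_def add.commute flip: tail)
  let ?t = "\<lambda>n. t (n + m)"
  have "infinite_repetition (map ?t [0..<p]) = ?t"
    using per p(1) by (intro infinite_repetition_periodic) (metis add.commute add.left_commute)+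
  then have "infinite_repetition (w @ v) \<in> \<Sigma>"
    using subshift_shifted[OF \<Sigma> t(1), of m] by (simp add: u map_shifted)
  moreover have "w @ v \<in> language (length (w @ v)) \<Sigma>"
    unfolding u language_def using t(1) by auto
  moreover have "w @ v \<noteq> []" using u p(1) by auto
  ultimately show ?thesis using that by blast
qed

section \<open>Contractive iterated function systems\<close>

locale contractive_ifs =
  fixes X :: "'a::metric_space set" and f :: "nat \<Rightarrow> 'a \<Rightarrow> 'a"
    and A :: "nat set" and \<Sigma> :: "(nat \<Rightarrow> nat) set" and c :: real
  assumes compact_space: "compact X" and nonempty_space: "X \<noteq> {}"
    and finite_alphabet: "finite A" and subshift: "subshift A \<Sigma>"
    and maps_space: "\<And>i. i \<in> A \<Longrightarrow> f i ` X \<subseteq> X"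
    and lipschitz: "\<And>i. i \<in> A \<Longrightarrow> c-lipschitz_on X (f i)"
    and factor: "0 \<le> c" "c < 1"
begin

lemma fold_invariant:
  assumes "\<And>i. i \<in> A \<Longrightarrow> f i ` Y \<subseteq> Y" "set u \<subseteq> A" "x \<in> Y"
  shows "fold f u x \<in> Y"
  using assms(2,3) by (induction u arbitrary: x) (use assms(1) in auto)

lemma fold_lipschitz:
  assumes "set u \<subseteq> A"
  shows "(c ^ length u)-lipschitz_on X (fold f u)"
  using assms
proof (induction u)
  case Nil
  then show ?case by (auto intro: lipschitz_onI)
next
  case (Cons i u)
  have "(c ^ length u)-lipschitz_on (f i ` X) (fold f u)"
    using Cons maps_space[of i] by (auto intro: lipschitz_on_subset)
  with Cons.prems have "(c ^ length u * c)-lipschitz_on X (fold f u \<circ> f i)"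
    by (intro lipschitz_on_compose lipschitz) auto
  then show ?case by (simp add: mult.commute)
qed

lemma language_nonempty: "language n \<Sigma> \<noteq> {}"
  using subshift by (auto simp: subshift_language[OF subshift] subshift_def)

lemma language_finite: "finite (language n \<Sigma>)"
  using subshift_language_letters[OF subshift] language_length
  by (blast intro: finite_subset[OF _ finite_lists_length_eq[OF finite_alphabet]])

lemma compact_hutchinson: "compact (hutchinson f \<Sigma> n X)"
  unfolding hutchinson_def
  using subshift_language_letters[OF subshift]
  by (intro compact_UN language_finite ballI compact_continuous_image compact_space
      lipschitz_on_continuous_on[OF fold_lipschitz]) auto

lemma hutchinson_nonempty: "hutchinson f \<Sigma> n X \<noteq> {}"
  unfolding hutchinson_def using nonempty_space language_nonempty by auto

lemma hutchinson_subset: "hutchinson f \<Sigma> n X \<subseteq> X"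
  unfolding hutchinson_def
  using fold_invariant[OF maps_space] subshift_language_letters[OF subshift] by blast

lemma decseq_hutchinson: "decseq (\<lambda>n. hutchinson f \<Sigma> n X)"
proof (rule decseq_SucI, rule subsetI)
  fix n y assume "y \<in> hutchinson f \<Sigma> (Suc n) X"
  then obtain u x where u: "u \<in> language (Suc n) \<Sigma>" and x: "x \<in> X" "y = fold f u x"
    unfolding hutchinson_def by blast
  obtain i v where iv: "u = i # v"
    using language_length[OF u] by (cases u) auto
  have "i \<in> A" using subshift_language_letters[OF subshift u] iv by simp
  then have "f i x \<in> X" using maps_space x by blast
  moreover have "v \<in> language n \<Sigma>" using subshift_language_tl[OF subshift u] iv by simp
  ultimately show "y \<in> hutchinson f \<Sigma> n X"
    unfolding hutchinson_def using x iv by auto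
qed

text \<open>
  This gives both existence and uniqueness of the attractor, so the description that defines
  it denotes the intersection of the iterates.
\<close>
lemma is_attractor_iff: "is_attractor X f \<Sigma> S \<longleftrightarrow> S = (\<Inter>n. hutchinson f \<Sigma> n X)"
proof -
  let ?T = "\<Inter>n. hutchinson f \<Sigma> n X"
  have "?T \<noteq> {}"
    using decseq_compact_subset_open[OF compact_hutchinson decseq_hutchinson, of "{}"]
      hutchinson_nonempty by auto
  moreover have T_subset: "?T \<subseteq> X" using hutchinson_subset by blast
  moreover have "compact ?T"
  proof -
    have "closed ?T" by (intro closed_INT ballI compact_imp_closed compact_hutchinson)
    then show ?thesis
      using compact_Int_closed[OF compact_space] T_subset by (metis Int_absorb1)
  qed
  moreover have "(\<lambda>n. hausdorff_distance (hutchinson f \<Sigma> n X) S) \<longlonglongrightarrow> 0 \<longleftrightarrow> S = ?T"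
    if "compact S" "S \<noteq> {}"
    using hausdorff_limit_decreasing_iff[OF compact_hutchinson hutchinson_nonempty
        decseq_hutchinson that] .
  ultimately show ?thesis unfolding is_attractor_def by metis
qed

lemma is_attractor_attractor: "is_attractor X f \<Sigma> (attractor X f \<Sigma>)"
  unfolding attractor_def by (rule theI') (simp add: is_attractor_iff)

lemmas attractor_eq_INT = is_attractor_attractor[unfolded is_attractor_iff]

text \<open>
  A word with \<open>y \<in> fold f u ` X\<close> exists for every length, since \<open>y\<close> lies in
  all iterates, and the image shrinks with the length. That the whole of \<open>X\<close> is sent near
  \<open>y\<close> makes the choice of \<open>u\<close> independent of the starting point and stable under
  adding letters in front of \<open>u\<close>.
\<close>
lemma eventually_image_in_ball:
  assumes y: "y \<in> attractor X f \<Sigma>" and e: "e > 0"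
  obtains M where "\<And>n. n \<ge> M \<Longrightarrow> \<exists>u\<in>language n \<Sigma>. fold f u ` X \<subseteq> ball y e"
proof -
  have "(\<lambda>n. c ^ n * diameter X) \<longlonglongrightarrow> 0"
    using factor by (intro tendsto_mult_left_zero LIMSEQ_realpow_zero)
  then have "\<forall>\<^sub>F n in sequentially. c ^ n * diameter X < e"
    using e by (rule order_tendstoD)
  then obtain M where M: "\<And>n. n \<ge> M \<Longrightarrow> c ^ n * diameter X < e"
    unfolding eventually_sequentially by blast
  have "\<exists>u\<in>language n \<Sigma>. fold f u ` X \<subseteq> ball y e" if n: "n \<ge> M" for n
  proof -
    have "y \<in> hutchinson f \<Sigma> n X" using y attractor_eq_INT by blast
    then obtain u x where u: "u \<in> language n \<Sigma>" and x: "x \<in> X" "y = fold f u x"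
      unfolding hutchinson_def by blast
    have lip: "(c ^ n)-lipschitz_on X (fold f u)"
      using fold_lipschitz subshift_language_letters[OF subshift u] language_length[OF u] by metis
    have "dist y (fold f u z) < e" if z: "z \<in> X" for z
    proof -
      have "dist y (fold f u z) \<le> c ^ n * dist x z"
        using lipschitz_onD[OF lip x(1) z] x(2) by simp
      also have "\<dots> \<le> c ^ n * diameter X"
        using factor compact_imp_bounded[OF compact_space] x z
        by (intro mult_left_mono diameter_bounded_bound) auto
      also have "\<dots> < e" using M n by blast
      finally show ?thesis .
    qed
    then show ?thesis using u by (intro bexI[of _ u]) auto
  qed
  then show ?thesis using that by blast
qed

end

section \<open>Dynamics on an invariant attractor\<close>

locale contractive_ifs_invariant_attractor = contractive_ifs +
  assumes attractor_invariant: "\<And>i. i \<in> A \<Longrightarrow> f i ` attractor X f \<Sigma> \<subseteq> attractor X f \<Sigma>"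
begin

abbreviation "S \<equiv> attractor X f \<Sigma>"

lemma attractor_subset: "S \<subseteq> X"
  using is_attractor_attractor unfolding is_attractor_def by blast

text \<open>
  Here invariance of the attractor enters: the word sends a point of \<open>U\<close> near a point of
  \<open>V\<close>, but \<open>V\<close> is only open relative to \<open>S\<close>, so the image must stay
  in \<open>S\<close>.
\<close>
lemma eventually_word_between:
  assumes U: "openin (top_of_set S) U" "U \<noteq> {}" and V: "openin (top_of_set S) V" "V \<noteq> {}"
  obtains M where "\<And>n. n \<ge> M \<Longrightarrow> \<exists>u\<in>language n \<Sigma>. U \<inter> fold f u -` V \<noteq> {}"
proof -
  obtain x where x: "x \<in> U" "x \<in> S" using U openin_imp_subset by blast
  obtain y where y: "y \<in> V" "y \<in> S" using V openin_imp_subset by blast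
  obtain e where e: "e > 0" "ball y e \<inter> S \<subseteq> V"
    using V(1) y(1) unfolding openin_contains_ball by blast
  obtain M where M: "\<And>n. n \<ge> M \<Longrightarrow> \<exists>u\<in>language n \<Sigma>. fold f u ` X \<subseteq> ball y e"
    using eventually_image_in_ball[OF y(2) e(1)] by blast
  have "\<exists>u\<in>language n \<Sigma>. U \<inter> fold f u -` V \<noteq> {}" if n: "n \<ge> M" for n
  proof -
    obtain u where u: "u \<in> language n \<Sigma>" "fold f u ` X \<subseteq> ball y e" using M n by blast
    have "fold f u x \<in> S"
      using fold_invariant[OF attractor_invariant subshift_language_letters[OF subshift u(1)] x(2)] .
    moreover have "fold f u x \<in> ball y e" using u(2) x(2) attractor_subset by blast
    ultimately show ?thesis using u(1) e(2) x(1) by blast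
  qed
  then show ?thesis using that by blast
qed

lemma mixing: "ifs_mixing S f \<Sigma>"
  unfolding ifs_mixing_def
proof (intro allI impI, elim conjE)
  fix U V assume "openin (top_of_set S) U" "U \<noteq> {}" "openin (top_of_set S) V" "V \<noteq> {}"
  then obtain M where M: "\<And>n. n \<ge> M \<Longrightarrow> \<exists>u\<in>language n \<Sigma>. U \<inter> fold f u -` V \<noteq> {}"
    using eventually_word_between by metis
  have "- ifs_times f \<Sigma> U V \<subseteq> {..M}"
  proof
    fix n assume "n \<in> - ifs_times f \<Sigma> U V"
    then have "\<not> (n \<ge> M \<and> n \<ge> 1)" using M unfolding ifs_times_def by auto
    then show "n \<in> {..M}" by auto
  qed
  then show "cofinite_set (ifs_times f \<Sigma> U V)"
    unfolding cofinite_set_def using finite_subset by blast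
qed

lemma totally_transitive: "ifs_totally_transitive S f \<Sigma>"
  unfolding ifs_totally_transitive_def ifs_transitive_def
proof (intro allI impI, elim conjE)
  fix N :: nat and U V
  assume N: "1 \<le> N"
    and "openin (top_of_set S) U" "U \<noteq> {}" "openin (top_of_set S) V" "V \<noteq> {}"
  then obtain M where M: "\<And>n. n \<ge> M \<Longrightarrow> \<exists>u\<in>language n \<Sigma>. U \<inter> fold f u -` V \<noteq> {}"
    using eventually_word_between by metis
  \<comment> \<open>\<open>M + 1\<close> blocks instead of \<open>M\<close>, because return times are positive.\<close>
  have "M * 1 \<le> (M + 1) * N" using N by (intro mult_le_mono) auto
  then have "M \<le> (M + 1) * N" by simp
  then obtain u where u: "u \<in> language ((M + 1) * N) \<Sigma>" "U \<inter> fold f u -` V \<noteq> {}"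
    using M by blast
  obtain w where "w \<in> language (M + 1) (power_shift N \<Sigma>)" "concat w = u"
    using language_concat_power_shift[OF subshift u(1)] .
  then have "M + 1 \<in> ifs_times (fold f) (power_shift N \<Sigma>) U V"
    using u(2) unfolding ifs_times_def by (auto simp: fold_fold_eq_fold_concat)
  then show "ifs_times (fold f) (power_shift N \<Sigma>) U V \<noteq> {}" by blast
qed

text \<open>
  The fixed point is taken in \<open>S\<close> rather than in \<open>X\<close>, by applying the Banach fixed
  point theorem to the restriction to \<open>S\<close>. It lies in \<open>fold f v ` X\<close> because
  \<open>v\<close> is the suffix of the word and hence applied last.
\<close>
lemma dense_periodic_points:
  assumes dense: "\<Sigma> \<subseteq> closure (ds_periodic_points \<Sigma> shift_map)"
  shows "S \<subseteq> closure (ifs_periodic_points S f \<Sigma>)"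
proof
  fix y assume y: "y \<in> S"
  show "y \<in> closure (ifs_periodic_points S f \<Sigma>)"
    unfolding closure_approachable
  proof (intro allI impI)
    fix e :: real assume "e > 0"
    then obtain m v where v: "v \<in> language m \<Sigma>" "fold f v ` X \<subseteq> ball y e"
      using eventually_image_in_ball[OF y] by (metis order_refl)
    obtain w where w: "w @ v \<noteq> []" "w @ v \<in> language (length (w @ v)) \<Sigma>"
      "infinite_repetition (w @ v) \<in> \<Sigma>"
      using dense_periodic_word_extension[OF subshift dense v(1)] .
    let ?u = "w @ v"
    have letters: "set ?u \<subseteq> A" using subshift_language_letters[OF subshift w(2)] .
    have "\<exists>!z\<in>S. fold f ?u z = z"
    proof (rule Banach_fix)
      show "complete S" "S \<noteq> {}"
        using is_attractor_attractor compact_imp_complete unfolding is_attractor_def by blast+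
      show "0 \<le> c ^ length ?u" using factor by simp
      show "c ^ length ?u < 1"
        using factor w(1) by (simp add: power_less_one_iff)
      show "fold f ?u ` S \<subseteq> S"
        using fold_invariant[OF attractor_invariant letters] by blast
      show "dist (fold f ?u a) (fold f ?u b) \<le> c ^ length ?u * dist a b" if "a \<in> S" "b \<in> S" for a b
        using lipschitz_onD[OF fold_lipschitz[OF letters]] that attractor_subset by blast
    qed
    then obtain z where z: "z \<in> S" "fold f ?u z = z" by blast
    have "fold f w z \<in> X"
      using fold_invariant[OF maps_space] letters z(1) attractor_subset by auto
    then have "fold f v (fold f w z) \<in> ball y e" using v(2) by blast
    then have "dist z y < e" using z(2) by (simp add: dist_commute)
    moreover have "z \<in> ifs_periodic_points S f \<Sigma>"
    proof -
      have "length ?u \<ge> 1" using w(1) by (simp add: Suc_le_eq)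
      then show ?thesis unfolding ifs_periodic_points_def using z w by blast
    qed
    ultimately show "\<exists>z\<in>ifs_periodic_points S f \<Sigma>. dist z y < e" by blast
  qed
qed

end

section \<open>Consequences of mixing\<close>

lemma cofinite_set_imp_thick:
  assumes "cofinite_set B"
  shows "thick B"
proof -
  obtain m where "\<And>n. n \<notin> B \<Longrightarrow> n < m"
    using assms unfolding cofinite_set_def finite_nat_set_iff_bounded by auto
  then have "{m..m + l} \<subseteq> B" for l
    by (metis atLeastAtMost_iff linorder_not_less subsetI)
  then show ?thesis unfolding thick_def by blast
qed

lemma ifs_mixing_imp_weak_mixing: "ifs_mixing Y f \<Sigma> \<Longrightarrow> ifs_weak_mixing Y f \<Sigma>"
  unfolding ifs_mixing_def ifs_weak_mixing_def using cofinite_set_imp_thick by blast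

lemma ifs_weak_mixing_imp_transitive: "ifs_weak_mixing Y f \<Sigma> \<Longrightarrow> ifs_transitive Y f \<Sigma>"
  unfolding ifs_weak_mixing_def ifs_transitive_def thick_def by fastforce

theorem corollary3p32:
  fixes X S :: "'a::metric_space set"
    and k :: nat
    and \<Sigma> :: "(nat \<Rightarrow> nat) set"
    and f :: "nat \<Rightarrow> 'a \<Rightarrow> 'a"
    and r :: "nat \<Rightarrow> real"
  assumes "compact X" and "X \<noteq> {}"
    and "k \<ge> 2"
    and "subshift {1..k} \<Sigma>"
    and "\<And>i. i \<in> {1..k} \<Longrightarrow> f i ` X \<subseteq> X"
    and "\<And>i. i \<in> {1..k} \<Longrightarrow> r i < 1 \<and> (r i)-lipschitz_on X (f i)"
    and "S = attractor X f \<Sigma>"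
    and "\<And>i. i \<in> {1..k} \<Longrightarrow> f i ` S \<subseteq> S"
  shows "(ds_devaney_chaotic \<Sigma> shift_map \<longrightarrow> ifs_devaney_chaotic S f \<Sigma>) \<and>
    (ds_mixing \<Sigma> shift_map \<longrightarrow> ifs_mixing S f \<Sigma>) \<and>
    (ds_weak_mixing \<Sigma> shift_map \<longrightarrow> ifs_weak_mixing S f \<Sigma>) \<and>
    (ds_totally_transitive \<Sigma> shift_map \<longrightarrow> ifs_totally_transitive S f \<Sigma>)"
proof -
  define c where "c = Max (r ` {1..k})"
  have ne: "{1..k} \<noteq> {}" using assms(3) by simp
  have r_le: "r i \<le> c" if "i \<in> {1..k}" for i
    unfolding c_def using that by (intro Max_ge) auto
  have "c \<in> r ` {1..k}" unfolding c_def using ne by (intro Max_in) auto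
  then have c: "0 \<le> c" "c < 1" using assms(6) lipschitz_on_nonneg by blast+
  interpret ifs: contractive_ifs_invariant_attractor X f "{1..k}" \<Sigma> c
  proof
    show "c-lipschitz_on X (f i)" if "i \<in> {1..k}" for i
      using assms(6)[OF that] r_le[OF that] by (blast intro: lipschitz_on_le)
    show "f i ` attractor X f \<Sigma> \<subseteq> attractor X f \<Sigma>" if "i \<in> {1..k}" for i
      using assms(7,8) that by blast
  qed (use assms c in auto)
  have "ifs_weak_mixing S f \<Sigma>"
    using ifs_mixing_imp_weak_mixing[OF ifs.mixing] assms(7) by simp
  moreover have "ifs_devaney_chaotic S f \<Sigma>" if "ds_devaney_chaotic \<Sigma> shift_map"
    using that ifs.dense_periodic_points ifs_weak_mixing_imp_transitive[OF \<open>ifs_weak_mixing S f \<Sigma>\<close>] assms(7)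
    unfolding ds_devaney_chaotic_def ifs_devaney_chaotic_def by simp
  ultimately show ?thesis using ifs.mixing ifs.totally_transitive assms(7) by simp
qed

end
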